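(* Let $\kappa>0$, $0<p<1$, $\nu\ge0$, let $T_p\sim\mathrm{NB}(\kappa,p)$ and let $\{X_i\}_{i\ge1}$ be a sequence of random variables; define $S_n=\sum_{i=1}^nX_i$. Assume that $\mathbb{E}(X_i\mid T_p)=1$ and $\mathrm{Var}(S_i\mid T_p=i)=i\nu^2$ for all $i\ge1$. Then $W_p=p\sum_{i=1}^{T_p}X_i$ satisfies $$d_{\mathrm W}(\mathscr{L}(W_p),\Gamma(\kappa,1))\le4\sqrt{\frac{6\kappa(1-p)p}{\kappa(1-p)+2}}+\frac{4\kappa(1-p)p}{\kappa(1-p)+2}+\nu\sqrt{\kappa(1-p)p}+p\kappa.$$
   Context: $V\sim\mathrm{NB}(\kappa,p)$ means $\mathbb{P}(V=i)=\frac{\Gamma(\kappa+i)}{\Gamma(\kappa)\,i!}p^\kappa(1-p)^i$, $i=0,1,2,\dots$. $\mathscr{L}(X)$ is the law of $X$; an empty sum is $0$. $\Gamma(r,\alpha)$ is the distribution with density $\frac{1}{\Gamma(r)}\alpha^r x^{r-1}e^{-\alpha x}$, $x>0$. $d_{\mathrm W}(\mathscr{L}(X),\mathscr{L}(Y))=\sup_{f}|\mathbb{E}f(X)-\mathbb{E}f(Y)|$ over all $f:\mathbb{R}\to\mathbb{R}$ with $|f(x)-f(y)|\le|x-y|$ for all $x,y\in\mathbb{R}$. *)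

theory Defs
  imports "HOL-Probability.Probability"
begin

definition neg_binomial_mass :: "real \<Rightarrow> real \<Rightarrow> nat \<Rightarrow> real" where
  "neg_binomial_mass \<kappa> p i =
     Gamma (\<kappa> + real i) / (Gamma \<kappa> * fact i) * p powr \<kappa> * (1 - p) ^ i"

definition neg_binomial_distributed :: "'a measure \<Rightarrow> ('a \<Rightarrow> nat) \<Rightarrow> real \<Rightarrow> real \<Rightarrow> bool" where
  "neg_binomial_distributed M V \<kappa> p \<longleftrightarrow>
     V \<in> measurable M (count_space UNIV) \<and>
     (\<forall>i. measure M {\<omega> \<in> space M. V \<omega> = i} = neg_binomial_mass \<kappa> p i)"

text \<open>Shape \<open>r\<close> and rate \<open>\<alpha>\<close>; the library's \<^const>\<open>erlang_density\<close> covers integer shapes only.\<close>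

definition gamma_density :: "real \<Rightarrow> real \<Rightarrow> real \<Rightarrow> real" where
  "gamma_density r \<alpha> x =
     (if x > 0 then 1 / Gamma r * \<alpha> powr r * x powr (r - 1) * exp (- \<alpha> * x) else 0)"

definition gamma_distribution :: "real \<Rightarrow> real \<Rightarrow> real measure" where
  "gamma_distribution r \<alpha> = density lborel (\<lambda>x. ennreal (gamma_density r \<alpha> x))"

text \<open>
  The supremum may be infinite, so it is taken in \<^typ>\<open>ereal\<close>. The Bochner integral of a
  non-integrable function is \<open>0\<close>; in order not to compare such default values, the distance is
  \<open>\<infinity>\<close> as soon as some test function has no expectation. A finite bound on the distance
  thus includes the existence of all expectations that occur in it.
\<close>

definition wasserstein_dist :: "real measure \<Rightarrow> real measure \<Rightarrow> ereal" where
  "wasserstein_dist \<mu> \<rho> =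
     (SUP f \<in> {f :: real \<Rightarrow> real. \<forall>x y. \<bar>f x - f y\<bar> \<le> \<bar>x - y\<bar>}.
        if integrable \<mu> f \<and> integrable \<rho> f
        then ereal \<bar>(\<integral>x. f x \<partial>\<mu>) - (\<integral>x. f x \<partial>\<rho>)\<bar> else \<infinity>)"

text \<open>
  \<open>X\<close> has a finite second moment given the event \<open>A\<close>, and its conditional variance given
  \<open>A\<close> (its variance under the conditional probability measure) is \<open>v\<close>. Without the first
  part, \<open>v = 0\<close> could also be the default value of the integral.
\<close>

definition has_variance_given :: "'a measure \<Rightarrow> ('a \<Rightarrow> real) \<Rightarrow> 'a set \<Rightarrow> real \<Rightarrow> bool" where
  "has_variance_given M X A v \<longleftrightarrow>
     integrable (uniform_measure M A) (\<lambda>\<omega>. (X \<omega>)\<^sup>2) \<and>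
     prob_space.variance (uniform_measure M A) X = v"

end

theory Submission imports Defs begin

text \<open>
  Conditionally on \<open>T\<close>, the random sum has mean \<open>T\<close> and variance \<open>T * \<nu>\<^sup>2\<close>, so replacing it by
  \<open>T\<close> costs \<open>p * sqrt (\<nu>\<^sup>2 * E T)\<close>, the third term of the bound. It remains to compare \<open>p * T\<close>
  with a gamma variable \<open>Z\<close>, which works without Stein's method. The point masses of \<open>T\<close> and of
  \<open>N = \<lceil>Z / p\<rceil>\<close> cross only once, so \<open>T\<close> is stochastically dominated by \<open>N\<close>, and \<open>p * N \<le> Z + p\<close>.
  For nonexpansive \<open>f\<close> the functions \<open>x + f x\<close> and \<open>x - f x\<close> are monotone; hence
  \<open>p * T\<close> and \<open>Z + p\<close> are no further apart than their means, which gives a distance of at most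
  \<open>p * \<kappa> + 2 * p\<close> between \<open>p * T\<close> and \<open>Z\<close>. Comparing both with \<open>0\<close> gives the alternative bound
  \<open>E (p * T) + E Z = p * \<kappa> + 2 * \<kappa> * (1 - p)\<close>, and the smaller of the two is below the claim.
\<close>

lemma Gamma_plus1_pos: "0 < x \<Longrightarrow> Gamma (x + 1) = x * Gamma (x :: real)"
  by (rule Gamma_plus1) (auto elim!: nonpos_Ints_cases)

section \<open>Expectations of integer-valued variables as series, and single crossing\<close>

text \<open>Writing the law as a weighted counting measure lets integrability and expectation of a
  function of \<open>N\<close> be read off from series over the point probabilities.\<close>

lemma (in prob_space) distr_nat_valued:
  assumes N [measurable]: "N \<in> measurable M (count_space UNIV)"
  shows "distr M (count_space UNIV) N =
    density (count_space UNIV) (\<lambda>k::nat. ennreal (prob {\<omega> \<in> space M. N \<omega> = k}))"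
proof (rule measure_eqI_countable[where A = UNIV])
  fix k :: nat
  have "N -` {k} \<inter> space M = {\<omega> \<in> space M. N \<omega> = k}" by auto
  then show "emeasure (distr M (count_space UNIV) N) {k} =
      emeasure (density (count_space UNIV) (\<lambda>k. ennreal (prob {\<omega> \<in> space M. N \<omega> = k}))) {k}"
    by (simp add: emeasure_distr emeasure_density emeasure_eq_measure
        nn_integral_count_space_indicator[symmetric] nn_integral_count_space_finite)
qed simp_all

lemma (in prob_space) nat_valued_integrable_iff:
  fixes g :: "nat \<Rightarrow> real"
  assumes N [measurable]: "N \<in> measurable M (count_space UNIV)"
  shows "integrable M (\<lambda>\<omega>. g (N \<omega>)) \<longleftrightarrow>
    summable (\<lambda>k. prob {\<omega> \<in> space M. N \<omega> = k} * \<bar>g k\<bar>)"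
proof -
  have "integrable M (\<lambda>\<omega>. g (N \<omega>)) \<longleftrightarrow> integrable (distr M (count_space UNIV) N) g"
    by (subst integrable_distr_eq) simp_all
  also have "\<dots> \<longleftrightarrow> integrable (count_space UNIV) (\<lambda>k. prob {\<omega> \<in> space M. N \<omega> = k} * g k)"
    unfolding distr_nat_valued[OF N] by (subst integrable_real_density) simp_all
  finally show ?thesis
    by (simp add: integrable_count_space_nat_iff abs_mult)
qed

lemma (in prob_space) nat_valued_expectation_sums:
  fixes g :: "nat \<Rightarrow> real"
  assumes N [measurable]: "N \<in> measurable M (count_space UNIV)"
    and g: "integrable M (\<lambda>\<omega>. g (N \<omega>))"
  shows "(\<lambda>k. prob {\<omega> \<in> space M. N \<omega> = k} * g k) sums expectation (\<lambda>\<omega>. g (N \<omega>))"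
proof -
  have *: "integrable (count_space UNIV) (\<lambda>k. prob {\<omega> \<in> space M. N \<omega> = k} * g k)"
    using g unfolding nat_valued_integrable_iff[OF N]
    by (simp add: integrable_count_space_nat_iff abs_mult)
  have "expectation (\<lambda>\<omega>. g (N \<omega>)) = integral\<^sup>L (distr M (count_space UNIV) N) g"
    by (subst integral_distr) simp_all
  also have "\<dots> = integral\<^sup>L (count_space UNIV) (\<lambda>k. prob {\<omega> \<in> space M. N \<omega> = k} * g k)"
    unfolding distr_nat_valued[OF N] by (subst integral_real_density) simp_all
  finally show ?thesis
    using sums_integral_count_space_nat[OF *] by simp
qed

text \<open>By \<open>cross\<close>, \<open>b - a\<close> changes sign at most once, from
  nonpositive to nonnegative. With \<open>m\<close> the crossing index, \<open>b k - a k\<close> and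
  \<open>g k - g m\<close> have the same sign for every \<open>k\<close>, and the constant
  \<open>g m\<close> does not matter because \<open>a\<close> and \<open>b\<close> have the same
  total.\<close>

lemma single_crossing_dominance:
  fixes a b g :: "nat \<Rightarrow> real"
  assumes "a sums s" "b sums s" "mono g"
    and "(\<lambda>k. a k * g k) sums x" "(\<lambda>k. b k * g k) sums y"
    and cross: "\<And>k l. a k < b k \<Longrightarrow> k \<le> l \<Longrightarrow> a l \<le> b l"
  shows "x \<le> y"
proof -
  have d: "(\<lambda>k. a k - b k) sums 0"
    using sums_diff[OF assms(1,2)] by simp
  show ?thesis
  proof (cases "\<exists>k. a k < b k")
    \<comment> \<open>Without a crossing, \<open>a - b\<close> is nonnegative with sum
      \<open>0\<close>, hence zero.\<close>
    case False
    then have "\<And>k. 0 \<le> a k - b k" by (auto simp: not_less)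
    with d have "\<And>k. a k - b k = 0"
      using suminf_eq_zero_iff[of "\<lambda>k. a k - b k"] by (auto simp: sums_iff)
    then have "a = b" by auto
    with assms(4,5) have "x = y" by (blast intro: sums_unique2)
    then show ?thesis by simp
  next
    case True
    define m where "m = (LEAST k. a k < b k)"
    have m: "a m < b m"
      unfolding m_def by (rule LeastI_ex[OF True])
    have below: "b k \<le> a k" if "k < m" for k
      using not_less_Least[OF that[unfolded m_def]] by simp
    \<comment> \<open>The added term has sum \<open>0\<close>; with it each summand becomes
      \<open>(b k - a k) * (g k - g m)\<close>.\<close>
    have lim: "(\<lambda>k. (b k * g k - a k * g k) + g m * (a k - b k)) sums (y - x + g m * 0)"
      by (intro sums_add sums_diff sums_mult assms(4,5) d)
    have "0 \<le> (b k * g k - a k * g k) + g m * (a k - b k)" for k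
    proof -
      have "0 \<le> (b k - a k) * (g k - g m)"
      proof (cases "k < m")
        case True
        with below[OF True] monoD[OF \<open>mono g\<close>, of k m] show ?thesis
          by (intro mult_nonpos_nonpos) auto
      next
        case False
        with cross[OF m, of k] monoD[OF \<open>mono g\<close>, of m k] show ?thesis
          by (intro mult_nonneg_nonneg) auto
      qed
      then show ?thesis by (simp add: algebra_simps)
    qed
    then have "0 \<le> y - x + g m * 0"
      using sums_le[OF _ sums_zero lim] by simp
    then show ?thesis by simp
  qed
qed

section \<open>The gamma distribution: total mass and mean\<close>

lemma nn_integral_gamma_density:
  assumes "r > 0"
  shows "(\<integral>\<^sup>+x. ennreal (gamma_density r 1 x) \<partial>lborel) = 1"
proof -
  have G: "Gamma r > 0" using assms by (rule Gamma_real_pos)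
  have "(\<integral>\<^sup>+x. ennreal (gamma_density r 1 x) \<partial>lborel) =
      (\<integral>\<^sup>+x. ennreal (1 / Gamma r) * ennreal (indicator {0..} x * x powr (r - 1) / exp x) \<partial>lborel)"
    \<comment> \<open>At \<open>x = 0\<close> both integrands vanish, since
      \<open>0 powr (r - 1) = 0\<close> by convention.\<close>
    using G by (intro nn_integral_cong)
      (auto simp: gamma_density_def indicator_def exp_minus field_simps simp flip: ennreal_mult)
  also have "\<dots> = ennreal (1 / Gamma r) * ennreal (Gamma r)"
    by (subst nn_integral_cmult) (simp_all add: Gamma_conv_nn_integral_real[OF assms])
  also have "\<dots> = 1"
    using G by (simp flip: ennreal_mult)
  finally show ?thesis .
qed

lemma gamma_density_measurable [measurable]: "gamma_density r \<alpha> \<in> borel_measurable borel"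
  unfolding gamma_density_def[abs_def] by measurable

lemma sets_gamma_distribution [simp, measurable_cong]: "sets (gamma_distribution r \<alpha>) = sets borel"
  by (simp add: gamma_distribution_def)

lemma space_gamma_distribution [simp]: "space (gamma_distribution r \<alpha>) = UNIV"
  by (simp add: gamma_distribution_def)

lemma prob_space_gamma_distribution: "r > 0 \<Longrightarrow> prob_space (gamma_distribution r 1)"
  by (intro prob_spaceI)
    (simp add: gamma_distribution_def emeasure_density nn_integral_gamma_density)

lemma AE_gamma_distribution_pos: "AE x in gamma_distribution r \<alpha>. 0 < x"
  unfolding gamma_distribution_def
  by (subst AE_density) (auto simp: gamma_density_def)

text \<open>Multiplying the density of shape \<open>r\<close> by \<open>x\<close> gives
  \<open>r\<close> times the density of shape \<open>r + 1\<close>, whose total mass is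
  \<open>1\<close>.\<close>

lemma gamma_distribution_mean:
  assumes "r > 0"
  shows "has_bochner_integral (gamma_distribution r 1) (\<lambda>x. x) r"
proof (rule has_bochner_integral_nn_integral)
  have G: "Gamma r > 0" using assms by (rule Gamma_real_pos)
  have [simp]: "gamma_density r \<alpha> x \<ge> 0" for \<alpha> x
    using G by (simp add: gamma_density_def)
  have "(\<integral>\<^sup>+x. ennreal x \<partial>gamma_distribution r 1) =
      (\<integral>\<^sup>+x. ennreal r * ennreal (gamma_density (r + 1) 1 x) \<partial>lborel)"
    unfolding gamma_distribution_def
  proof (subst nn_integral_density; (intro nn_integral_cong)?)
    fix x :: real
    show "ennreal (gamma_density r 1 x) * ennreal x = ennreal r * ennreal (gamma_density (r + 1) 1 x)"
    proof (cases "x > 0")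
      case True
      have "x powr r = x powr (r - 1) * x"
        using True by (simp add: powr_diff)
      moreover have "Gamma (r + 1) = r * Gamma r"
        using assms by (intro Gamma_plus1_pos) simp
      ultimately have "gamma_density r 1 x * x = r * gamma_density (r + 1) 1 x"
        using True assms G by (simp add: gamma_density_def)
      then show ?thesis
        using True assms by (simp flip: ennreal_mult')
    qed (simp add: gamma_density_def)
  qed simp_all
  also have "\<dots> = ennreal r"
    using assms by (subst nn_integral_cmult) (simp_all add: nn_integral_gamma_density)
  finally show "(\<integral>\<^sup>+x. ennreal x \<partial>gamma_distribution r 1) = ennreal r" .
  show "AE x in gamma_distribution r 1. 0 \<le> x"
    using AE_gamma_distribution_pos by (rule eventually_mono) simp
qed (use assms in simp_all)

section \<open>Negative binomial masses and their mean\<close>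

lemma neg_binomial_mass_pos:
  "\<kappa> > 0 \<Longrightarrow> 0 < p \<Longrightarrow> p < 1 \<Longrightarrow> neg_binomial_mass \<kappa> p i > 0"
  unfolding neg_binomial_mass_def
  by (intro mult_pos_pos divide_pos_pos Gamma_real_pos) auto

lemma neg_binomial_mass_Suc:
  assumes "\<kappa> > 0"
  shows "real (Suc i) * neg_binomial_mass \<kappa> p (Suc i) =
    (1 - p) * (\<kappa> + real i) * neg_binomial_mass \<kappa> p i"
proof -
  have "Gamma (\<kappa> + real i + 1) = (\<kappa> + real i) * Gamma (\<kappa> + real i)"
    using assms by (intro Gamma_plus1_pos) simp
  moreover have "Gamma \<kappa> > 0" using assms by (rule Gamma_real_pos)
  ultimately show ?thesis
    by (simp add: neg_binomial_mass_def add.commute add.left_commute divide_simps)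
qed

text \<open>The recursion for the masses turns the mean \<open>m\<close> into a solution of
  \<open>m = (1 - p) * (\<kappa> + m)\<close>.\<close>

lemma neg_binomial_mean_sums:
  assumes "\<kappa> > 0" "0 < p" "p < 1" and s: "neg_binomial_mass \<kappa> p sums 1"
  shows "(\<lambda>i. neg_binomial_mass \<kappa> p i * real i) sums (\<kappa> * (1 - p) / p)"
proof -
  let ?m = "neg_binomial_mass \<kappa> p"
  have nn: "0 \<le> ?m i" for i
    using neg_binomial_mass_pos[OF assms(1-3), of i] by simp
  have step: "?m (Suc i) * real (Suc i) = (1 - p) * (\<kappa> * ?m i + ?m i * real i)" for i
    using neg_binomial_mass_Suc[OF assms(1), of i p] by (simp add: algebra_simps)
  \<comment> \<open>Before the mean may be used as a number, its series must converge. A partial sum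
    \<open>s\<close> is at most the next one, which the recursion bounds by
    \<open>(1 - p) * (\<kappa> + s)\<close>; solving for \<open>s\<close> gives a bound uniform in
    \<open>n\<close>.\<close>
  have bound: "(\<Sum>i<n. ?m i * real i) \<le> \<kappa> * (1 - p) / p" for n
  proof -
    have S: "(\<Sum>i<n. ?m i * real i) \<le> (\<Sum>i<Suc n. ?m i * real i)"
      using nn by simp
    also have "\<dots> = (\<Sum>i<n. (1 - p) * (\<kappa> * ?m i + ?m i * real i))"
      by (subst sum.lessThan_Suc_shift) (simp add: step del: of_nat_Suc)
    also have "\<dots> = (1 - p) * (\<kappa> * (\<Sum>i<n. ?m i) + (\<Sum>i<n. ?m i * real i))"
      by (simp only: distrib_left sum.distrib sum_distrib_left)
    also have "(\<Sum>i<n. ?m i) \<le> 1"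
      using s nn sum_le_suminf[of ?m "{..<n}"] by (auto simp: sums_iff)
    finally have "(\<Sum>i<n. ?m i * real i) \<le> (1 - p) * (\<kappa> * 1 + (\<Sum>i<n. ?m i * real i))"
      using assms(1,3) by (simp add: mult_left_mono)
    then show ?thesis
      using assms(2) by (simp add: field_simps)
  qed
  have sm: "summable (\<lambda>i. ?m i * real i)"
    by (rule summableI_nonneg_bounded[OF _ bound]) (simp add: nn)
  define m where "m = (\<Sum>i. ?m i * real i)"
  have m: "(\<lambda>i. ?m i * real i) sums m"
    using sm by (simp add: m_def summable_sums)
  have "(\<lambda>i. (1 - p) * (\<kappa> * ?m i + ?m i * real i)) sums ((1 - p) * (\<kappa> * 1 + m))"
    by (intro sums_mult sums_add s m)
  then have "(\<lambda>i. ?m (Suc i) * real (Suc i)) sums ((1 - p) * (\<kappa> * 1 + m))"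
    by (simp only: step)
  \<comment> \<open>The shift of the index is harmless because the term at \<open>0\<close> is
    \<open>0\<close>.\<close>
  then have "(\<lambda>i. ?m i * real i) sums ((1 - p) * (\<kappa> * 1 + m))"
    by (subst (asm) sums_Suc_iff) simp
  with m have "m = (1 - p) * (\<kappa> + m)"
    by (simp add: sums_unique2)
  then have "m = \<kappa> * (1 - p) / p"
    using assms(2) by (simp add: field_simps)
  with m show ?thesis by simp
qed

section \<open>Gamma probabilities of the cells of length \<open>p\<close> against negative binomial
  masses\<close>

text \<open>Log-convexity of \<open>Gamma\<close> on the segment from \<open>x\<close> to
  \<open>x + 1\<close>: the point \<open>x + s\<close> has weights \<open>1 - s\<close> and
  \<open>s\<close>, and \<open>ln (Gamma (x + 1))\<close> exceeds \<open>ln (Gamma x)\<close> by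
  \<open>ln x\<close>.\<close>

lemma Gamma_plus_le_powr:
  assumes "0 < s" "s \<le> 1" "0 < x"
  shows "Gamma (x + s) \<le> Gamma x * x powr (s::real)"
proof -
  have "(ln \<circ> Gamma) ((1 - s) *\<^sub>R x + s *\<^sub>R (x + 1)) \<le>
      (1 - s) * (ln \<circ> Gamma) x + s * (ln \<circ> Gamma) (x + 1)"
    using assms by (intro convex_onD[OF log_convex_Gamma_real]) auto
  moreover have "(1 - s) *\<^sub>R x + s *\<^sub>R (x + 1) = x + s"
    by (simp add: algebra_simps)
  moreover have G: "Gamma x > 0" "Gamma (x + s) > 0"
    using assms by (auto intro: Gamma_real_pos)
  moreover have "Gamma (x + 1) = x * Gamma x"
    using assms by (intro Gamma_plus1_pos) simp
  ultimately have "ln (Gamma (x + s)) \<le> ln (Gamma x) + s * ln x"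
    using assms by (simp add: ln_mult_pos algebra_simps)
  also have "\<dots> = ln (Gamma x * x powr s)"
    using assms G by (simp add: ln_mult_pos ln_powr)
  finally show ?thesis
    using assms G by (subst (asm) ln_le_cancel_iff) auto
qed

lemma emeasure_gamma_distribution:
  "A \<in> sets borel \<Longrightarrow> emeasure (gamma_distribution r \<alpha>) A =
    (\<integral>\<^sup>+x. ennreal (gamma_density r \<alpha> x) * indicator A x \<partial>lborel)"
  by (simp add: gamma_distribution_def emeasure_density)

text \<open>The cells are half-open intervals of length \<open>p\<close>. Cell \<open>0\<close> is
  different: \<open>nat\<close> sends every nonpositive \<open>x\<close> there.\<close>

lemma nat_ceiling_divide_eq_iff:
  fixes x p :: real
  assumes "p > 0" "k \<ge> 1"
  shows "nat \<lceil>x / p\<rceil> = k \<longleftrightarrow> p * (real k - 1) < x \<and> x \<le> p * real k"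
proof -
  have "nat \<lceil>x / p\<rceil> = k \<longleftrightarrow> \<lceil>x / p\<rceil> = int k"
    using assms(2) by linarith
  also have "\<dots> \<longleftrightarrow> real k - 1 < x / p \<and> x / p \<le> real k"
    by (simp add: ceiling_eq_iff)
  also have "\<dots> \<longleftrightarrow> p * (real k - 1) < x \<and> x \<le> p * real k"
    using assms(1) by (simp add: field_simps)
  finally show ?thesis .
qed

text \<open>From \<open>x \<le> p * k\<close> follows
  \<open>x / (x + p) \<le> k / (k + 1) = 1 - y \<le> exp (- y)\<close> with
  \<open>y = 1 / (k + 1)\<close>; then raise to the power \<open>b\<close> and use
  \<open>1 + y * b \<le> exp (y * b)\<close>. For \<open>b = \<kappa> - 1\<close> the factor is
  \<open>(\<kappa> + k) / (k + 1)\<close>, the ratio of consecutive masses without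
  \<open>1 - p\<close>.\<close>

lemma powr_step_lower_bound:
  fixes x p b k :: real
  assumes "0 \<le> b" "0 < k" "0 < x" "x \<le> p * k"
  shows "(1 + b / (k + 1)) * x powr b \<le> (x + p) powr b"
proof -
  define y where "y = 1 / (k + 1)"
  have "x / (x + p) \<le> k / (k + 1)"
    using assms zero_less_mult_pos2[of p k] by (simp add: field_simps)
  also have "k / (k + 1) \<le> exp (- y)"
    using exp_ge_add_one_self[of "- y"] assms(2) by (simp add: y_def field_simps)
  finally have "x * exp y \<le> x + p"
    using assms zero_less_mult_pos2[of p k] by (simp add: exp_minus field_simps)
  then have "(x * exp y) powr b \<le> (x + p) powr b"
    using assms by (intro powr_mono2) auto
  moreover have "(x * exp y) powr b = exp (y * b) * x powr b"
    using assms by (simp add: powr_mult exp_powr_real)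
  moreover have "(1 + b / (k + 1)) * x powr b \<le> exp (y * b) * x powr b"
    using exp_ge_add_one_self[of "y * b"] by (intro mult_right_mono) (simp_all add: y_def)
  ultimately show ?thesis by linarith
qed

text \<open>For \<open>\<kappa> \<ge> 1\<close> the ratio of the cell probabilities to the negative binomial masses is nondecreasing;
  the factor below is the ratio of consecutive masses.\<close>

lemma gamma_cell_step:
  fixes p \<kappa> :: real
  assumes "\<kappa> \<ge> 1" "0 < p" "p < 1" "k \<ge> (1::nat)"
  defines "\<G> \<equiv> gamma_distribution \<kappa> 1"
  shows "(1 - p) * (\<kappa> + real k) / real (Suc k) * measure \<G> {x. nat \<lceil>x / p\<rceil> = k}
    \<le> measure \<G> {x. nat \<lceil>x / p\<rceil> = Suc k}"
proof -
  interpret prob_space \<G>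
    unfolding \<G>_def using assms by (intro prob_space_gamma_distribution) simp
  define I where "I k = {x. nat \<lceil>x / p\<rceil> = k}" for k
  have I [measurable]: "I k \<in> sets borel" for k unfolding I_def by measurable
  define c where "c = (1 - p) * (\<kappa> + real k) / real (Suc k)"
  have c: "c \<ge> 0" unfolding c_def using assms by simp
  let ?d = "gamma_density \<kappa> 1"
  have G: "Gamma \<kappa> > 0" using assms by (intro Gamma_real_pos) simp
  then have nn [simp]: "?d x \<ge> 0" for x by (simp add: gamma_density_def)
  have shift: "x + p \<in> I (Suc k) \<longleftrightarrow> x \<in> I k" for x
    using assms by (simp add: I_def nat_ceiling_divide_eq_iff algebra_simps)
  have cell_nonneg: "0 \<le> p * (real k - 1)" using assms by simp
  have pw: "c * ?d x \<le> ?d (x + p)" if "x \<in> I k" for x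
  proof -
    have "p * (real k - 1) < x" "x \<le> p * real k"
      using that assms by (auto simp: I_def nat_ceiling_divide_eq_iff)
    with cell_nonneg have x: "0 < x" "x \<le> p * real k" by linarith+
    \<comment> \<open>The second factor is absorbed by the growth of the power from \<open>x\<close>
      to \<open>x + p\<close>, the first by the exponential decay, as
      \<open>1 - p \<le> exp (- p)\<close>.\<close>
    have "c = (1 - p) * (1 + (\<kappa> - 1) / (real k + 1))"
      by (simp add: c_def field_simps)
    then have "c * x powr (\<kappa> - 1) \<le> (1 - p) * (x + p) powr (\<kappa> - 1)"
      using powr_step_lower_bound[of "\<kappa> - 1" "real k" x p] assms x
      by (simp add: mult.assoc mult_left_mono)
    also have "\<dots> \<le> exp (- p) * (x + p) powr (\<kappa> - 1)"
      using exp_ge_add_one_self[of "- p"] by (intro mult_right_mono) simp_all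
    finally have "c * x powr (\<kappa> - 1) * (exp (- x) / Gamma \<kappa>)
        \<le> exp (- p) * (x + p) powr (\<kappa> - 1) * (exp (- x) / Gamma \<kappa>)"
      using G by (intro mult_right_mono) simp_all
    moreover have "exp (- (x + p)) = exp (- p) * exp (- x)"
      by (simp add: mult_exp_exp)
    ultimately show ?thesis
      using x assms by (simp add: gamma_density_def mult_ac)
  qed
  have "ennreal c * emeasure \<G> (I k) = (\<integral>\<^sup>+x. ennreal c * (ennreal (?d x) * indicator (I k) x) \<partial>lborel)"
    unfolding \<G>_def by (simp add: emeasure_gamma_distribution nn_integral_cmult)
  \<comment> \<open>Translation by \<open>p\<close> carries cell \<open>k\<close> onto cell
    \<open>k + 1\<close>, so the pointwise inequality integrates to one between the cells. The form
    \<open>p + 1 * x\<close> fits the affine change of variables.\<close>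
  also have "\<dots> \<le> (\<integral>\<^sup>+x. ennreal (?d (p + 1 * x)) * indicator (I (Suc k)) (p + 1 * x) \<partial>lborel)"
  proof (intro nn_integral_mono)
    fix x
    show "ennreal c * (ennreal (?d x) * indicator (I k) x)
      \<le> ennreal (?d (p + 1 * x)) * indicator (I (Suc k)) (p + 1 * x)"
      using pw[of x] shift[of x] c
      by (cases "x \<in> I k") (auto simp: add.commute simp flip: ennreal_mult intro: ennreal_leI)
  qed
  also have "\<dots> = emeasure \<G> (I (Suc k))"
    unfolding \<G>_def
    by (subst emeasure_gamma_distribution, simp, subst nn_integral_real_affine[where c = 1 and t = p])
      simp_all
  finally show ?thesis
    using c unfolding c_def[symmetric] I_def[symmetric] emeasure_eq_measure
    by (simp flip: ennreal_mult)
qed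

text \<open>For \<kappa> \<le> 1 the gamma density decreases on the positive axis, so the
  probability of a cell is at least \<open>p\<close> times the density at its right end
  \<open>p * k\<close>. This already exceeds the mass, by the bound on
  \<open>Gamma (\<kappa> + k)\<close> and \<open>(1 - p) ^ k \<le> exp (- (p * k))\<close>.\<close>

lemma neg_binomial_mass_le_gamma_cell:
  fixes p \<kappa> :: real
  assumes "0 < \<kappa>" "\<kappa> \<le> 1" "0 < p" "p < 1" "k \<ge> (1::nat)"
  shows "neg_binomial_mass \<kappa> p k \<le> measure (gamma_distribution \<kappa> 1) {x. nat \<lceil>x / p\<rceil> = k}"
proof -
  interpret prob_space "gamma_distribution \<kappa> 1"
    using assms by (intro prob_space_gamma_distribution) simp
  have G: "Gamma \<kappa> > 0" using assms by (intro Gamma_real_pos) simp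
  have k: "real k > 0" using assms by simp
  have cell: "{x. nat \<lceil>x / p\<rceil> = k} = {p * (real k - 1)<..p * real k}"
    using assms by (auto simp: nat_ceiling_divide_eq_iff)
  \<comment> \<open>The value of the density at the right end of the cell.\<close>
  define d where "d = (p * real k) powr (\<kappa> - 1) * exp (- (p * real k)) / Gamma \<kappa>"
  have d: "d \<ge> 0" using G by (simp add: d_def)
  have cell_nonneg: "0 \<le> p * (real k - 1)" using assms by simp
  have pw: "d \<le> gamma_density \<kappa> 1 x" if "x \<in> {p * (real k - 1)<..p * real k}" for x
  proof -
    have "p * (real k - 1) < x" "x \<le> p * real k"
      using that by auto
    with cell_nonneg have x: "0 < x" "x \<le> p * real k" by linarith+
    have "(p * real k) powr (\<kappa> - 1) * exp (- (p * real k)) \<le> x powr (\<kappa> - 1) * exp (- x)"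
      using x assms by (intro mult_mono powr_mono2') auto
    then show ?thesis
      using x G by (simp add: d_def gamma_density_def divide_right_mono)
  qed
  have "fact k = real k * Gamma (real k)"
    using Gamma_plus1_pos[OF k] Gamma_fact[of k, where 'a = real] by (simp add: add.commute)
  moreover have "Gamma (\<kappa> + real k) \<le> Gamma (real k) * real k powr \<kappa>"
    using Gamma_plus_le_powr[of \<kappa> "real k"] assms by (simp add: add.commute)
  moreover have "Gamma (real k) > 0" using k by (rule Gamma_real_pos)
  ultimately have "Gamma (\<kappa> + real k) / fact k \<le> real k powr (\<kappa> - 1)"
    using k by (simp add: powr_diff field_simps)
  moreover have "(1 - p) ^ k \<le> exp (- (p * real k))"
  proof -
    have "(1 - p) ^ k \<le> exp (- p) ^ k"
      using exp_ge_add_one_self[of "- p"] assms by (intro power_mono) auto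
    then show ?thesis by (simp flip: exp_of_nat_mult add: mult.commute)
  qed
  ultimately have "Gamma (\<kappa> + real k) / fact k * (1 - p) ^ k * (p powr \<kappa> / Gamma \<kappa>)
      \<le> real k powr (\<kappa> - 1) * exp (- (p * real k)) * (p powr \<kappa> / Gamma \<kappa>)"
    using G assms by (intro mult_right_mono mult_mono) auto
  also have "\<dots> = d * p"
    using assms k by (simp add: d_def powr_mult powr_diff)
  finally have "ennreal (neg_binomial_mass \<kappa> p k) \<le> ennreal d * ennreal p"
    using d assms by (simp add: neg_binomial_mass_def mult_ac flip: ennreal_mult)
  also have "ennreal p = emeasure lborel {p * (real k - 1)<..p * real k}"
    using assms by (simp add: algebra_simps)
  also have "ennreal d * emeasure lborel {p * (real k - 1)<..p * real k} =
      (\<integral>\<^sup>+x. ennreal d * indicator {p * (real k - 1)<..p * real k} x \<partial>lborel)"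
    by (rule nn_integral_cmult_indicator[symmetric]) simp
  also have "\<dots> \<le> emeasure (gamma_distribution \<kappa> 1) {x. nat \<lceil>x / p\<rceil> = k}"
    unfolding cell
    by (subst emeasure_gamma_distribution)
      (auto intro!: nn_integral_mono ennreal_leI pw split: split_indicator)
  finally show ?thesis
    by (simp add: emeasure_eq_measure)
qed

text \<open>For \<kappa> \<le> 1 the cells dominate at every index from \<open>1\<close> on. For
  \<kappa> > 1 the inequality propagates from \<open>k\<close> upwards: each step multiplies the
  mass by exactly the factor by which the cell probability grows at least.\<close>

lemma neg_binomial_gamma_cell_crossing:
  fixes p \<kappa> :: real
  assumes "0 < \<kappa>" "0 < p" "p < 1"
  defines "b \<equiv> \<lambda>k. measure (gamma_distribution \<kappa> 1) {x. nat \<lceil>x / p\<rceil> = k}"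
  assumes kl: "neg_binomial_mass \<kappa> p k < b k" "k \<le> l"
  shows "neg_binomial_mass \<kappa> p l \<le> b l"
proof -
  interpret prob_space "gamma_distribution \<kappa> 1"
    using assms by (intro prob_space_gamma_distribution) simp
  note pos = neg_binomial_mass_pos[OF assms(1-3)]
  \<comment> \<open>Cell \<open>0\<close> has probability \<open>0\<close> while the mass at
    \<open>0\<close> is positive, so a crossing index is at least \<open>1\<close>, as the
    comparison of cells requires.\<close>
  have "AE x in gamma_distribution \<kappa> 1. \<not> (nat \<lceil>x / p\<rceil> = 0)"
    using AE_gamma_distribution_pos by (rule eventually_mono) (use assms in \<open>simp add: field_simps\<close>)
  then have "prob {x \<in> space (gamma_distribution \<kappa> 1). nat \<lceil>x / p\<rceil> = 0} = 0"
    by (intro prob_eq_0[THEN iffD2]) auto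
  then have "b 0 = 0" by (simp add: b_def)
  with kl(1) pos[of 0] have k: "k \<ge> 1" by (cases k) auto
  show ?thesis
  proof (cases "\<kappa> \<le> 1")
    case True
    then show ?thesis
      unfolding b_def using assms k by (intro neg_binomial_mass_le_gamma_cell) auto
  next
    case False
    show ?thesis
      using kl(2)
    proof (induction l rule: dec_induct)
      case base
      with kl(1) show ?case by simp
    next
      case (step n)
      have "neg_binomial_mass \<kappa> p (Suc n) =
          (1 - p) * (\<kappa> + real n) / real (Suc n) * neg_binomial_mass \<kappa> p n"
        using neg_binomial_mass_Suc[OF assms(1), of n p] by (simp add: field_simps)
      also have "\<dots> \<le> (1 - p) * (\<kappa> + real n) / real (Suc n) * b n"
        using step assms by (intro mult_left_mono) auto
      also have "\<dots> \<le> b (Suc n)"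
        unfolding b_def using False assms k step by (intro gamma_cell_step) auto
      finally show ?case .
    qed
  qed
qed

section \<open>Stochastic domination and the distance of \<open>p * T\<close> from the gamma
  law\<close>

lemma neg_binomial_dominated_by_gamma:
  fixes h :: "real \<Rightarrow> real"
  assumes "prob_space M" "0 < \<kappa>" "0 < p" "p < 1" and T: "neg_binomial_distributed M T \<kappa> p"
    and h: "mono h"
    and iT: "integrable M (\<lambda>\<omega>. h (p * real (T \<omega>)))"
    and iG: "integrable (gamma_distribution \<kappa> 1) (\<lambda>x. h (x + p))"
  shows "(\<integral>\<omega>. h (p * real (T \<omega>)) \<partial>M) \<le> (\<integral>x. h (x + p) \<partial>gamma_distribution \<kappa> 1)"
proof -
  interpret prob_space M by fact
  let ?G = "gamma_distribution \<kappa> 1"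
  interpret G: prob_space ?G
    using assms by (intro prob_space_gamma_distribution) simp
  define N where "N x = nat \<lceil>x / p\<rceil>" for x
  have N [measurable]: "N \<in> measurable ?G (count_space UNIV)"
    unfolding N_def[abs_def] by measurable
  have [measurable]: "T \<in> measurable M (count_space UNIV)"
    and mass: "prob {\<omega> \<in> space M. T \<omega> = k} = neg_binomial_mass \<kappa> p k" for k
    using T by (auto simp: neg_binomial_distributed_def)
  \<comment> \<open>The lower bound serves integrability: \<open>h (p * N)\<close> lies between a
    constant and an integrable function. The upper bound is the rounding error
    \<open>p * N \<le> x + p\<close>, used at the end.\<close>
  have AE: "AE x in ?G. h 0 \<le> h (p * real (N x)) \<and> h (p * real (N x)) \<le> h (x + p)"
    using AE_gamma_distribution_pos
  proof (rule eventually_mono)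
    fix x :: real assume x: "0 < x"
    have "real (N x) = of_int \<lceil>x / p\<rceil>"
      using x assms by (simp add: N_def)
    also have "\<dots> \<le> x / p + 1" by linarith
    finally have "p * real (N x) \<le> p * (x / p + 1)"
      using assms by (intro mult_left_mono) auto
    then have "p * real (N x) \<le> x + p"
      using assms by (simp add: algebra_simps)
    then show "h 0 \<le> h (p * real (N x)) \<and> h (p * real (N x)) \<le> h (x + p)"
      using assms by (auto intro!: monoD[OF h])
  qed
  have iN: "integrable ?G (\<lambda>x. h (p * real (N x)))"
  proof (rule Bochner_Integration.integrable_bound)
    show "integrable ?G (\<lambda>x. \<bar>h 0\<bar> + \<bar>h (x + p)\<bar>)"
      using iG by auto
    show "AE x in ?G. norm (h (p * real (N x))) \<le> norm (\<bar>h 0\<bar> + \<bar>h (x + p)\<bar>)"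
      using AE by (rule eventually_mono) auto
  qed measurable
  have "(\<integral>\<omega>. h (p * real (T \<omega>)) \<partial>M) \<le> (\<integral>x. h (p * real (N x)) \<partial>?G)"
  proof (rule single_crossing_dominance)
    \<comment> \<open>The masses are the point probabilities of \<open>T\<close>, so their total is
      that of the probability space.\<close>
    show "neg_binomial_mass \<kappa> p sums 1"
      using nat_valued_expectation_sums[of T "\<lambda>_. 1"] by (simp add: mass prob_space)
    show "(\<lambda>k. G.prob {x \<in> space ?G. N x = k}) sums 1"
      using G.nat_valued_expectation_sums[of N "\<lambda>_. 1"] G.prob_space by simp
    show "mono (\<lambda>k. h (p * real k))"
      using assms by (intro monoI monoD[OF h] mult_left_mono) auto
    show "(\<lambda>k. neg_binomial_mass \<kappa> p k * h (p * real k)) sums (\<integral>\<omega>. h (p * real (T \<omega>)) \<partial>M)"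
      using nat_valued_expectation_sums[of T "\<lambda>k. h (p * real k)"] iT by (simp add: mass)
    show "(\<lambda>k. G.prob {x \<in> space ?G. N x = k} * h (p * real k)) sums (\<integral>x. h (p * real (N x)) \<partial>?G)"
      by (rule G.nat_valued_expectation_sums[of N "\<lambda>k. h (p * real k)", OF N iN])
    show "neg_binomial_mass \<kappa> p l \<le> G.prob {x \<in> space ?G. N x = l}"
      if "neg_binomial_mass \<kappa> p k < G.prob {x \<in> space ?G. N x = k}" "k \<le> l" for k l
      using neg_binomial_gamma_cell_crossing[OF assms(2-4), of k l] that by (simp add: N_def)
  qed
  also have "\<dots> \<le> (\<integral>x. h (x + p) \<partial>?G)"
    using AE by (intro integral_mono_AE iN iG) auto
  finally show ?thesis .
qed

lemma nonexpansive_borel_measurable: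
  fixes f :: "real \<Rightarrow> real"
  assumes "\<forall>x y. \<bar>f x - f y\<bar> \<le> \<bar>x - y\<bar>"
  shows "f \<in> borel_measurable borel"
proof -
  have "1-lipschitz_on UNIV f"
    using assms by (intro lipschitz_onI) (auto simp: dist_real_def)
  then show ?thesis
    by (intro borel_measurable_continuous_onI lipschitz_on_continuous_on)
qed

text \<open>A nonexpansive function grows at most linearly:
  \<open>\<bar>f y\<bar> \<le> \<bar>f 0\<bar> + \<bar>y\<bar>\<close>.\<close>

lemma (in prob_space) nonexpansive_integrable:
  fixes f :: "real \<Rightarrow> real"
  assumes f: "\<forall>x y. \<bar>f x - f y\<bar> \<le> \<bar>x - y\<bar>" and Y: "integrable M Y"
  shows "integrable M (\<lambda>\<omega>. f (Y \<omega>))"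
proof (rule Bochner_Integration.integrable_bound)
  show "integrable M (\<lambda>\<omega>. \<bar>f 0\<bar> + \<bar>Y \<omega>\<bar>)" using Y by auto
  show "(\<lambda>\<omega>. f (Y \<omega>)) \<in> borel_measurable M"
    by (rule measurable_compose[OF borel_measurable_integrable[OF Y] nonexpansive_borel_measurable[OF f]])
  have bound: "\<bar>f y\<bar> \<le> \<bar>f 0\<bar> + \<bar>y\<bar>" for y
    using f[rule_format, of y 0] by simp
  then show "AE \<omega> in M. norm (f (Y \<omega>)) \<le> norm (\<bar>f 0\<bar> + \<bar>Y \<omega>\<bar>)"
    by (simp add: bound)
qed

lemma neg_binomial_mean:
  assumes "prob_space M" "0 < \<kappa>" "0 < p" "p < 1" "neg_binomial_distributed M T \<kappa> p"
  shows "has_bochner_integral M (\<lambda>\<omega>. real (T \<omega>)) (\<kappa> * (1 - p) / p)"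
proof -
  interpret prob_space M by fact
  have T [measurable]: "T \<in> measurable M (count_space UNIV)"
    and mass: "prob {\<omega> \<in> space M. T \<omega> = k} = neg_binomial_mass \<kappa> p k" for k
    using assms(5) by (auto simp: neg_binomial_distributed_def)
  have "neg_binomial_mass \<kappa> p sums 1"
    using nat_valued_expectation_sums[of T "\<lambda>_. 1"] by (simp add: mass prob_space)
  then have s: "(\<lambda>i. neg_binomial_mass \<kappa> p i * real i) sums (\<kappa> * (1 - p) / p)"
    using assms by (intro neg_binomial_mean_sums) auto
  then have i: "integrable M (\<lambda>\<omega>. real (T \<omega>))"
    by (subst nat_valued_integrable_iff[OF T]) (simp add: mass sums_iff)
  show ?thesis
    using i nat_valued_expectation_sums[OF T i] s
    by (auto simp: has_bochner_integral_iff mass dest: sums_unique2)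
qed

text \<open>Domination gives \<open>p * \<kappa> + 2 * p\<close>, and comparison of both laws with
  the point mass at \<open>0\<close> gives \<open>\<kappa> * (1 - p) + \<kappa> = p * \<kappa> + 2 *
  (\<kappa> * (1 - p))\<close>; the minimum collects the two.\<close>

lemma neg_binomial_gamma_distance:
  assumes "prob_space M" "0 < \<kappa>" "0 < p" "p < 1" and T: "neg_binomial_distributed M T \<kappa> p"
    and f: "\<forall>x y. \<bar>f x - f y\<bar> \<le> \<bar>x - y\<bar>"
  shows "\<bar>(\<integral>\<omega>. f (p * real (T \<omega>)) \<partial>M) - (\<integral>x. f x \<partial>gamma_distribution \<kappa> 1)\<bar>
    \<le> p * \<kappa> + 2 * min p (\<kappa> * (1 - p))"
proof -
  interpret prob_space M by fact
  let ?G = "gamma_distribution \<kappa> 1"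
  interpret G: prob_space ?G
    using assms by (intro prob_space_gamma_distribution) simp
  have mT: "integrable M (\<lambda>\<omega>. p * real (T \<omega>))" "(\<integral>\<omega>. p * real (T \<omega>) \<partial>M) = \<kappa> * (1 - p)"
    using neg_binomial_mean[OF assms(1-5)] assms(3) by (auto simp: has_bochner_integral_iff)
  have mG: "integrable ?G (\<lambda>x. x)" "(\<integral>x. x \<partial>?G) = \<kappa>"
    using gamma_distribution_mean[OF assms(2)] by (auto simp: has_bochner_integral_iff)
  have mGp: "integrable ?G (\<lambda>x. x + p)" "(\<integral>x. x + p \<partial>?G) = \<kappa> + p"
    using mG G.prob_space by auto
  have iT: "integrable M (\<lambda>\<omega>. f (p * real (T \<omega>)))"
    by (rule nonexpansive_integrable[OF f mT(1)])
  have iG: "integrable ?G f" by (rule G.nonexpansive_integrable[OF f mG(1)])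
  have iGp: "integrable ?G (\<lambda>x. f (x + p))" by (rule G.nonexpansive_integrable[OF f mGp(1)])
  let ?t = "\<integral>\<omega>. f (p * real (T \<omega>)) \<partial>M" and ?g = "\<integral>x. f x \<partial>?G"
  let ?s = "\<integral>x. f (x + p) \<partial>?G"
  have triv: "\<bar>?t - ?g\<bar> \<le> \<kappa> * (1 - p) + \<kappa>"
  proof -
    have "\<bar>?t - f 0\<bar> \<le> \<kappa> * (1 - p)"
    proof -
      have "\<bar>?t - f 0\<bar> = \<bar>\<integral>\<omega>. f (p * real (T \<omega>)) - f 0 \<partial>M\<bar>"
        using iT prob_space by simp
      also have "\<dots> \<le> (\<integral>\<omega>. \<bar>f (p * real (T \<omega>)) - f 0\<bar> \<partial>M)"
        by (rule integral_abs_bound)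
      also have "\<dots> \<le> (\<integral>\<omega>. p * real (T \<omega>) \<partial>M)"
      proof (intro integral_mono mT)
        show "\<bar>f (p * real (T \<omega>)) - f 0\<bar> \<le> p * real (T \<omega>)" for \<omega>
          using f[rule_format, of "p * real (T \<omega>)" 0] assms by simp
      qed (use iT in simp)
      finally show ?thesis by (simp only: mT)
    qed
    moreover have "\<bar>?g - f 0\<bar> \<le> \<kappa>"
    proof -
      have "\<bar>?g - f 0\<bar> = \<bar>\<integral>x. f x - f 0 \<partial>?G\<bar>"
        using iG G.prob_space by simp
      also have "\<dots> \<le> (\<integral>x. \<bar>f x - f 0\<bar> \<partial>?G)"
        by (rule integral_abs_bound)
      also have "\<dots> \<le> (\<integral>x. x \<partial>?G)"
      proof (intro integral_mono_AE mG)
        show "AE x in ?G. \<bar>f x - f 0\<bar> \<le> x"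
          using AE_gamma_distribution_pos
        proof (rule eventually_mono)
          fix x :: real assume "0 < x"
          then show "\<bar>f x - f 0\<bar> \<le> x"
            using f[rule_format, of x 0] by simp
        qed
      qed (use iG in simp)
      finally show ?thesis by (simp only: mG)
    qed
    ultimately show ?thesis by linarith
  qed
  have m: "mono (\<lambda>x. x + f x)" "mono (\<lambda>x. x - f x)"
  proof -
    have "x + f x \<le> y + f y \<and> x - f x \<le> y - f y" if "x \<le> y" for x y
      using f[rule_format, of x y] that by linarith
    then show "mono (\<lambda>x. x + f x)" "mono (\<lambda>x. x - f x)"
      by (auto intro: monoI)
  qed
  \<comment> \<open>Domination for \<open>x + f x\<close> and for \<open>x - f x\<close> bounds
    \<open>?t - ?s\<close> from both sides by the difference of the means,
    \<open>\<kappa> + p - \<kappa> * (1 - p)\<close>. Undoing the shift from \<open>?s\<close> to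
    \<open>?g\<close> costs another \<open>p\<close>.\<close>
  have "(\<integral>\<omega>. p * real (T \<omega>) + f (p * real (T \<omega>)) \<partial>M) \<le> (\<integral>x. (x + p) + f (x + p) \<partial>?G)"
    using assms(1-5) m(1)
    by (rule neg_binomial_dominated_by_gamma) (use mT iT mGp iGp in auto)
  moreover have "(\<integral>\<omega>. p * real (T \<omega>) - f (p * real (T \<omega>)) \<partial>M) \<le> (\<integral>x. (x + p) - f (x + p) \<partial>?G)"
    using assms(1-5) m(2)
    by (rule neg_binomial_dominated_by_gamma) (use mT iT mGp iGp in auto)
  moreover have "\<bar>?s - ?g\<bar> \<le> p"
  proof -
    have "\<bar>?s - ?g\<bar> = \<bar>\<integral>x. f (x + p) - f x \<partial>?G\<bar>"
      using iG iGp by simp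
    also have "\<dots> \<le> (\<integral>x. \<bar>f (x + p) - f x\<bar> \<partial>?G)"
      by (rule integral_abs_bound)
    also have "\<dots> \<le> (\<integral>x. p \<partial>?G)"
    proof (intro integral_mono)
      show "\<bar>f (x + p) - f x\<bar> \<le> p" for x
        using f[rule_format, of "x + p" x] assms by simp
    qed (use iG iGp in simp_all)
    finally show ?thesis using G.prob_space by simp
  qed
  moreover have "(\<integral>\<omega>. p * real (T \<omega>) + f (p * real (T \<omega>)) \<partial>M) = \<kappa> * (1 - p) + ?t"
    "(\<integral>\<omega>. p * real (T \<omega>) - f (p * real (T \<omega>)) \<partial>M) = \<kappa> * (1 - p) - ?t"
    "(\<integral>x. (x + p) + f (x + p) \<partial>?G) = \<kappa> + p + ?s"
    "(\<integral>x. (x + p) - f (x + p) \<partial>?G) = \<kappa> + p - ?s"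
    using mT iT mGp iGp by (simp_all only: Bochner_Integration.integral_add Bochner_Integration.integral_diff)
  ultimately have "\<bar>?t - ?g\<bar> \<le> \<kappa> + p - \<kappa> * (1 - p) + p"
    by linarith
  with triv show ?thesis
    by (auto simp: min_def algebra_simps)
qed

section \<open>Conditioning on the value of \<open>T\<close> and the second moment of the random
  sum\<close>

text \<open>A real-valued density makes conditional integrals accessible to the rules for real
  densities.\<close>

lemma (in prob_space) uniform_measure_eq_density:
  assumes [measurable]: "A \<in> sets M" and "prob A > 0"
  shows "uniform_measure M A = density M (\<lambda>x. ennreal (indicator A x / prob A))"
  unfolding uniform_measure_def
  using assms by (intro density_cong)
    (auto simp: emeasure_eq_measure divide_ennreal ennreal_indicator[symmetric] simp del: ennreal_indicator)

lemma (in prob_space)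
  fixes f :: "'a \<Rightarrow> real"
  assumes A [measurable]: "A \<in> sets M" and pos: "prob A > 0" and f [measurable]: "f \<in> borel_measurable M"
  shows integrable_uniform_measure_iff:
      "integrable (uniform_measure M A) f \<longleftrightarrow> integrable M (\<lambda>x. indicator A x * f x)"
    and integral_uniform_measure_eq:
      "integral\<^sup>L (uniform_measure M A) f = expectation (\<lambda>x. indicator A x * f x) / prob A"
proof -
  show "integrable (uniform_measure M A) f \<longleftrightarrow> integrable M (\<lambda>x. indicator A x * f x)"
    unfolding uniform_measure_eq_density[OF A pos]
    using pos integrable_mult_right_iff[of M "\<lambda>x. indicator A x * f x" "1 / prob A"]
    by (subst integrable_real_density) simp_all
  show "integral\<^sup>L (uniform_measure M A) f = expectation (\<lambda>x. indicator A x * f x) / prob A"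
    unfolding uniform_measure_eq_density[OF A pos]
    using pos by (subst integral_real_density) simp_all
qed

text \<open>The event that \<open>T\<close> equals \<open>i\<close> lies in the \<sigma>-algebra
  generated by \<open>T\<close>, so integrating over it does not distinguish \<open>Y\<close> from
  its conditional expectation.\<close>

lemma (in prob_space) cond_exp_vimage_expectation:
  fixes T :: "'a \<Rightarrow> nat" and c :: real
  assumes T [measurable]: "T \<in> measurable M (count_space UNIV)" and Y: "integrable M Y"
    and ce: "AE \<omega> in M. real_cond_exp M (vimage_algebra (space M) T (count_space UNIV)) Y \<omega> = c"
  shows "expectation (\<lambda>\<omega>. indicator {\<omega> \<in> space M. T \<omega> = i} \<omega> * Y \<omega>) = c * prob {\<omega> \<in> space M. T \<omega> = i}"
proof -
  let ?F = "vimage_algebra (space M) T (count_space UNIV)"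
  let ?A = "{\<omega> \<in> space M. T \<omega> = i}"
  have sub: "subalgebra M ?F"
    using T by (simp add: subalgebra_def measurable_iff_sets)
  interpret finite_measure_subalgebra M ?F
    by unfold_locales (rule sub)
  have "?A = T -` {i} \<inter> space M" by auto
  then have A: "?A \<in> sets ?F"
    by (simp add: in_vimage_algebra)
  then have [measurable]: "?A \<in> sets M" using sub by (auto simp: subalgebra_def)
  have "expectation (\<lambda>\<omega>. indicator ?A \<omega> * Y \<omega>) = (\<integral>\<omega>\<in>?A. Y \<omega> \<partial>M)"
    by (simp add: set_lebesgue_integral_def)
  also have "\<dots> = (\<integral>\<omega>\<in>?A. real_cond_exp M ?F Y \<omega> \<partial>M)"
    by (rule real_cond_exp_intA[OF Y A])
  also have "\<dots> = (\<integral>\<omega>. indicator ?A \<omega> * c \<partial>M)"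
    unfolding set_lebesgue_integral_def
    using ce by (intro integral_cong_AE) auto
  also have "\<dots> = c * prob ?A" by simp
  finally show ?thesis .
qed

text \<open>The variance of \<open>\<bar>Y\<bar>\<close> is nonnegative.\<close>

lemma (in prob_space) expectation_abs_le_sqrt:
  fixes Y :: "'a \<Rightarrow> real"
  assumes [measurable]: "Y \<in> borel_measurable M" and v: "has_bochner_integral M (\<lambda>\<omega>. (Y \<omega>)\<^sup>2) v"
  shows "integrable M Y" "expectation (\<lambda>\<omega>. \<bar>Y \<omega>\<bar>) \<le> sqrt v"
proof -
  have v': "integrable M (\<lambda>\<omega>. (Y \<omega>)\<^sup>2)" "expectation (\<lambda>\<omega>. (Y \<omega>)\<^sup>2) = v"
    using v by (simp_all add: has_bochner_integral_iff)
  show i: "integrable M Y"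
    by (rule square_integrable_imp_integrable[OF assms(1) v'(1)])
  have "0 \<le> variance (\<lambda>\<omega>. \<bar>Y \<omega>\<bar>)" by (rule variance_positive)
  also have "\<dots> = expectation (\<lambda>\<omega>. \<bar>Y \<omega>\<bar>\<^sup>2) - (expectation (\<lambda>\<omega>. \<bar>Y \<omega>\<bar>))\<^sup>2"
    using i v'(1) by (intro variance_eq) simp_all
  finally have "(expectation (\<lambda>\<omega>. \<bar>Y \<omega>\<bar>))\<^sup>2 \<le> v"
    by (simp add: v'(2))
  then show "expectation (\<lambda>\<omega>. \<bar>Y \<omega>\<bar>) \<le> sqrt v"
    by (rule real_le_rsqrt)
qed

text \<open>Given that \<open>T\<close> equals \<open>i\<close>, the sum has mean \<open>i\<close>,
  so its second moment about \<open>i\<close> is its conditional variance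
  \<open>i * \<nu>\<^sup>2\<close>. Weighting with the probabilities of these events and summing
  leaves \<open>\<nu>\<^sup>2\<close> times the mean of \<open>T\<close>.\<close>

lemma (in prob_space) random_sum_second_moment:
  fixes T :: "'a \<Rightarrow> nat" and X :: "nat \<Rightarrow> 'a \<Rightarrow> real" and \<mu> \<nu> :: real
  assumes T [measurable]: "T \<in> measurable M (count_space UNIV)"
    and pos: "\<And>i. prob {\<omega> \<in> space M. T \<omega> = i} > 0"
    and ET: "has_bochner_integral M (\<lambda>\<omega>. real (T \<omega>)) \<mu>"
    and X: "\<And>i. i \<ge> 1 \<Longrightarrow> X i \<in> borel_measurable M" "\<And>i. i \<ge> 1 \<Longrightarrow> integrable M (X i)"
    and ce: "\<And>i. i \<ge> 1 \<Longrightarrow>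
           (AE \<omega> in M. real_cond_exp M (vimage_algebra (space M) T (count_space UNIV)) (X i) \<omega> = 1)"
    and var: "\<And>i. i \<ge> 1 \<Longrightarrow>
           has_variance_given M (\<lambda>\<omega>. \<Sum>j=1..i. X j \<omega>) {\<omega> \<in> space M. T \<omega> = i} (real i * \<nu>\<^sup>2)"
  shows "(\<lambda>\<omega>. \<Sum>i=1..T \<omega>. X i \<omega>) \<in> borel_measurable M"
    and "has_bochner_integral M (\<lambda>\<omega>. ((\<Sum>i=1..T \<omega>. X i \<omega>) - real (T \<omega>))\<^sup>2) (\<mu> * \<nu>\<^sup>2)"
proof -
  define S where "S i \<omega> = (\<Sum>j=1..i. X j \<omega>)" for i \<omega>
  define A where "A i = {\<omega> \<in> space M. T \<omega> = i}" for i
  have A [measurable]: "A i \<in> sets M" for i unfolding A_def by measurable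
  have S [measurable]: "S i \<in> borel_measurable M" for i
    unfolding S_def[abs_def] using X(1) by (intro borel_measurable_sum) auto
  have ST [measurable]: "(\<lambda>\<omega>. S (T \<omega>) \<omega>) \<in> borel_measurable M"
    by (rule measurable_compose_countable[OF S T])
  then show "(\<lambda>\<omega>. \<Sum>i=1..T \<omega>. X i \<omega>) \<in> borel_measurable M"
    by (simp add: S_def)
  have cell: "(\<integral>\<^sup>+\<omega>. ennreal ((S i \<omega> - real i)\<^sup>2) * indicator (A i) \<omega> \<partial>M) =
      ennreal (prob (A i) * real i * \<nu>\<^sup>2)" for i
  proof (cases "i \<ge> 1")
    \<comment> \<open>Only \<open>i = 0\<close> remains; the sum is empty and both sides are
      \<open>0\<close>.\<close>
    case False
    then show ?thesis by (cases i) (simp_all add: S_def)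
  next
    case True
    let ?U = "uniform_measure M (A i)"
    have posA: "prob (A i) > 0" using pos[of i] by (simp add: A_def)
    interpret U: prob_space ?U
      using posA by (intro prob_space_uniform_measure) (simp_all add: emeasure_eq_measure)
    have sq: "integrable ?U (\<lambda>\<omega>. (S i \<omega>)\<^sup>2)"
      and v: "U.variance (S i) = real i * \<nu>\<^sup>2"
      using var[OF True] unfolding has_variance_given_def A_def S_def by auto
    have "integrable ?U (S i)"
      by (rule U.square_integrable_imp_integrable[OF _ sq]) simp
    with sq have iU: "integrable ?U (\<lambda>\<omega>. (S i \<omega> - real i)\<^sup>2)"
      by (simp add: power2_diff)
    have iX: "integrable M (\<lambda>\<omega>. indicator (A i) \<omega> * X j \<omega>)" if "j \<ge> 1" for j
      using integrable_mult_indicator[OF A X(2)[OF that]] by simp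
    have "expectation (\<lambda>\<omega>. indicator (A i) \<omega> * S i \<omega>) =
        (\<Sum>j=1..i. expectation (\<lambda>\<omega>. indicator (A i) \<omega> * X j \<omega>))"
      unfolding S_def sum_distrib_left using iX by (subst Bochner_Integration.integral_sum) auto
    also have "\<dots> = (\<Sum>j=1..i. prob (A i))"
    proof (intro sum.cong refl)
      fix j assume "j \<in> {1..i}"
      then have "j \<ge> 1" by simp
      from cond_exp_vimage_expectation[OF T X(2)[OF this] ce[OF this], of i]
      show "expectation (\<lambda>\<omega>. indicator (A i) \<omega> * X j \<omega>) = prob (A i)"
        by (simp add: A_def)
    qed
    \<comment> \<open>This identifies the centre of the conditional variance with
      \<open>i\<close>.\<close>
    finally have "U.expectation (S i) = real i"
      using posA by (simp add: integral_uniform_measure_eq)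
    then have "expectation (\<lambda>\<omega>. indicator (A i) \<omega> * (S i \<omega> - real i)\<^sup>2) = prob (A i) * real i * \<nu>\<^sup>2"
      using v posA by (simp add: integral_uniform_measure_eq field_simps)
    moreover have "integrable M (\<lambda>\<omega>. indicator (A i) \<omega> * (S i \<omega> - real i)\<^sup>2)"
      using iU posA by (simp add: integrable_uniform_measure_iff)
    ultimately have "(\<integral>\<^sup>+\<omega>. ennreal (indicator (A i) \<omega> * (S i \<omega> - real i)\<^sup>2) \<partial>M) =
        ennreal (prob (A i) * real i * \<nu>\<^sup>2)"
      by (subst nn_integral_eq_integral) auto
    moreover have "ennreal (indicator (A i) \<omega> * (S i \<omega> - real i)\<^sup>2) =
        ennreal ((S i \<omega> - real i)\<^sup>2) * indicator (A i) \<omega>" for \<omega>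
      by (simp split: split_indicator)
    ultimately show ?thesis by simp
  qed
  have sT: "(\<lambda>i. prob (A i) * real i * \<nu>\<^sup>2) sums (\<mu> * \<nu>\<^sup>2)"
    using nat_valued_expectation_sums[OF T, of real] ET
    by (intro sums_mult2) (auto simp: has_bochner_integral_iff A_def)
  \<comment> \<open>Integrals of nonnegative functions may be exchanged with the sum
    unconditionally, so integrability and value come out together. At each point only the index
    \<open>T \<omega>\<close> contributes.\<close>
  have "(\<integral>\<^sup>+\<omega>. ennreal ((S (T \<omega>) \<omega> - real (T \<omega>))\<^sup>2) \<partial>M) =
      (\<integral>\<^sup>+\<omega>. (\<Sum>i. ennreal ((S i \<omega> - real i)\<^sup>2) * indicator (A i) \<omega>) \<partial>M)"
  proof (intro nn_integral_cong)
    fix \<omega> assume "\<omega> \<in> space M"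
    then have "\<omega> \<in> A (T \<omega>)" by (simp add: A_def)
    moreover have "disjoint_family A" by (auto simp: disjoint_family_on_def A_def)
    ultimately show "ennreal ((S (T \<omega>) \<omega> - real (T \<omega>))\<^sup>2) =
        (\<Sum>i. ennreal ((S i \<omega> - real i)\<^sup>2) * indicator (A i) \<omega>)"
      by (subst suminf_cmult_indicator) auto
  qed
  also have "\<dots> = (\<Sum>i. ennreal (prob (A i) * real i * \<nu>\<^sup>2))"
    by (subst nn_integral_suminf) (simp_all add: cell)
  also have "\<dots> = ennreal (\<mu> * \<nu>\<^sup>2)"
    using sT by (intro suminf_ennreal_eq) simp_all
  finally have "(\<integral>\<^sup>+\<omega>. ennreal ((S (T \<omega>) \<omega> - real (T \<omega>))\<^sup>2) \<partial>M) = ennreal (\<mu> * \<nu>\<^sup>2)" .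
  moreover have "0 \<le> \<mu> * \<nu>\<^sup>2"
    using sums_le[OF _ sums_zero sT] by simp
  ultimately show "has_bochner_integral M (\<lambda>\<omega>. ((\<Sum>i=1..T \<omega>. X i \<omega>) - real (T \<omega>))\<^sup>2) (\<mu> * \<nu>\<^sup>2)"
    unfolding S_def[symmetric] by (intro has_bochner_integral_nn_integral) auto
qed

section \<open>Elementary estimate and assembly of the bound\<close>

text \<open>Here \<open>q\<close> stands for \<open>\<kappa> * (1 - p)\<close>. Squaring reduces the
  claim to \<open>(min p q)\<^sup>2 * (q + 2) \<le> 24 * q * p\<close>. If \<open>q \<le> p\<close>,
  then \<open>q + 2 \<le> 3\<close>; otherwise \<open>p * (q + 2) \<le> 3 * q\<close>. Either way
  the constant \<open>3\<close> would do.\<close>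

lemma two_min_le_sqrt:
  fixes p q :: real
  assumes "0 < p" "p < 1" "0 < q"
  shows "2 * min p q \<le> 4 * sqrt (6 * q * p / (q + 2))"
proof -
  have "min p q * min p q * (q + 2) \<le> 24 * q * p"
  proof (cases "q \<le> p")
    case True
    then have "q * q * (q + 2) \<le> q * p * 3"
      using assms by (intro mult_mono) auto
    also have "\<dots> \<le> 24 * q * p" using assms by simp
    finally show ?thesis using True by (simp add: min_absorb2)
  next
    case False
    have "p * (q + 2) = p * q + 2 * p" by (simp add: algebra_simps)
    also have "\<dots> \<le> 1 * q + 2 * q"
      using assms False by (intro add_mono mult_right_mono) auto
    finally have "p * (p * (q + 2)) \<le> p * (24 * q)"
      using assms by (intro mult_left_mono) auto
    then show ?thesis using False by (simp add: min_absorb1 mult_ac)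
  qed
  then have "(min p q / 2)\<^sup>2 \<le> 6 * q * p / (q + 2)"
    using assms by (simp add: field_simps power2_eq_square)
  then have "min p q / 2 \<le> sqrt (6 * q * p / (q + 2))"
    by (rule real_le_rsqrt)
  then show ?thesis by simp
qed

theorem corollary4p8:
  fixes M :: "'a measure" and T :: "'a \<Rightarrow> nat" and X :: "nat \<Rightarrow> 'a \<Rightarrow> real"
    and \<kappa> p \<nu> :: real
  assumes "prob_space M"
    and "\<kappa> > 0" and "0 < p" and "p < 1" and "\<nu> \<ge> 0"
    and "neg_binomial_distributed M T \<kappa> p"
    and "\<And>i. i \<ge> 1 \<Longrightarrow> X i \<in> borel_measurable M"
    and "\<And>i. i \<ge> 1 \<Longrightarrow> integrable M (X i)"
    and "\<And>i. i \<ge> 1 \<Longrightarrow>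
           (AE \<omega> in M. real_cond_exp M (vimage_algebra (space M) T (count_space UNIV)) (X i) \<omega> = 1)"
    and "\<And>i. i \<ge> 1 \<Longrightarrow>
           has_variance_given M (\<lambda>\<omega>. \<Sum>j=1..i. X j \<omega>) {\<omega> \<in> space M. T \<omega> = i} (real i * \<nu>\<^sup>2)"
  shows "wasserstein_dist (distr M borel (\<lambda>\<omega>. p * (\<Sum>i=1..T \<omega>. X i \<omega>))) (gamma_distribution \<kappa> 1)
    \<le> ereal (4 * sqrt (6 * \<kappa> * (1 - p) * p / (\<kappa> * (1 - p) + 2))
             + 4 * \<kappa> * (1 - p) * p / (\<kappa> * (1 - p) + 2)
             + \<nu> * sqrt (\<kappa> * (1 - p) * p) + p * \<kappa>)"
proof -
  interpret prob_space M by fact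
  let ?G = "gamma_distribution \<kappa> 1"
  interpret G: prob_space ?G
    using assms by (intro prob_space_gamma_distribution) simp
  define S where "S \<omega> = (\<Sum>i=1..T \<omega>. X i \<omega>)" for \<omega>
  have T [measurable]: "T \<in> measurable M (count_space UNIV)"
    and mass: "prob {\<omega> \<in> space M. T \<omega> = k} = neg_binomial_mass \<kappa> p k" for k
    using assms(6) by (auto simp: neg_binomial_distributed_def)
  have pos: "prob {\<omega> \<in> space M. T \<omega> = k} > 0" for k
    using assms by (simp add: mass neg_binomial_mass_pos)
  note ET = neg_binomial_mean[OF assms(1-4,6)]
  note moment = random_sum_second_moment[OF T pos ET assms(7-10), folded S_def]
  have S [measurable]: "S \<in> borel_measurable M"
    using moment(1) by (simp add: S_def[abs_def])
  note dev = expectation_abs_le_sqrt[OF _ moment(2)]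
  have iD: "integrable M (\<lambda>\<omega>. S \<omega> - real (T \<omega>))" by (rule dev(1)) measurable
  have iT: "integrable M (\<lambda>\<omega>. p * real (T \<omega>))"
    using ET by (auto simp: has_bochner_integral_iff)
  \<comment> \<open>Integrability of the random sum is obtained from its square-integrable deviation
    from \<open>T\<close> and the finite mean of \<open>T\<close>.\<close>
  have "integrable M (\<lambda>\<omega>. p * (S \<omega> - real (T \<omega>)) + p * real (T \<omega>))"
    by (intro Bochner_Integration.integrable_add integrable_mult_right iD iT)
  then have iW: "integrable M (\<lambda>\<omega>. p * S \<omega>)"
    by (simp add: algebra_simps)
  have "p * expectation (\<lambda>\<omega>. \<bar>S \<omega> - real (T \<omega>)\<bar>) \<le> p * sqrt (\<kappa> * (1 - p) / p * \<nu>\<^sup>2)"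
    using assms by (intro mult_left_mono dev(2)) auto
  also have "\<dots> = sqrt (p\<^sup>2 * (\<kappa> * (1 - p) / p * \<nu>\<^sup>2))"
    using assms(3) by (simp only: real_sqrt_mult real_sqrt_abs abs_of_pos)
  also have "p\<^sup>2 * (\<kappa> * (1 - p) / p * \<nu>\<^sup>2) = \<nu>\<^sup>2 * (\<kappa> * (1 - p) * p)"
    using assms by (simp add: power2_eq_square)
  also have "sqrt \<dots> = \<nu> * sqrt (\<kappa> * (1 - p) * p)"
    using assms by (simp add: real_sqrt_mult)
  finally have D: "p * expectation (\<lambda>\<omega>. \<bar>S \<omega> - real (T \<omega>)\<bar>) \<le> \<nu> * sqrt (\<kappa> * (1 - p) * p)" .
  have main: "\<bar>expectation (\<lambda>\<omega>. f (p * S \<omega>)) - (\<integral>x. f x \<partial>?G)\<bar>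
      \<le> 4 * sqrt (6 * \<kappa> * (1 - p) * p / (\<kappa> * (1 - p) + 2))
             + 4 * \<kappa> * (1 - p) * p / (\<kappa> * (1 - p) + 2)
             + \<nu> * sqrt (\<kappa> * (1 - p) * p) + p * \<kappa>"
    if f: "\<forall>x y. \<bar>f x - f y\<bar> \<le> \<bar>x - y\<bar>" for f
  proof -
    note i1 = nonexpansive_integrable[OF f iW] and i2 = nonexpansive_integrable[OF f iT]
    \<comment> \<open>Since \<open>f\<close> is nonexpansive, replacing \<open>S\<close> by
      \<open>T\<close> under \<open>f\<close> costs at most \<open>p\<close> times the mean of
      \<open>\<bar>S - T\<bar>\<close>, which \<open>D\<close> bounds.\<close>
    have "\<bar>expectation (\<lambda>\<omega>. f (p * S \<omega>)) - expectation (\<lambda>\<omega>. f (p * real (T \<omega>)))\<bar>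
        = \<bar>expectation (\<lambda>\<omega>. f (p * S \<omega>) - f (p * real (T \<omega>)))\<bar>"
      using i1 i2 by simp
    also have "\<dots> \<le> expectation (\<lambda>\<omega>. \<bar>f (p * S \<omega>) - f (p * real (T \<omega>))\<bar>)"
      by (rule integral_abs_bound)
    also have "\<dots> \<le> expectation (\<lambda>\<omega>. p * \<bar>S \<omega> - real (T \<omega>)\<bar>)"
    proof (intro integral_mono)
      fix \<omega>
      have "\<bar>p * S \<omega> - p * real (T \<omega>)\<bar> = p * \<bar>S \<omega> - real (T \<omega>)\<bar>"
        using assms by (simp flip: right_diff_distrib add: abs_mult)
      then show "\<bar>f (p * S \<omega>) - f (p * real (T \<omega>))\<bar> \<le> p * \<bar>S \<omega> - real (T \<omega>)\<bar>"
        using f[rule_format, of "p * S \<omega>" "p * real (T \<omega>)"] by simp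
    qed (use i1 i2 iD in auto)
    also have "\<dots> \<le> \<nu> * sqrt (\<kappa> * (1 - p) * p)"
      using D by simp
    finally have "\<bar>expectation (\<lambda>\<omega>. f (p * S \<omega>)) - expectation (\<lambda>\<omega>. f (p * real (T \<omega>)))\<bar>
        \<le> \<nu> * sqrt (\<kappa> * (1 - p) * p)" .
    moreover note neg_binomial_gamma_distance[OF assms(1-4,6) f]
    moreover have "2 * min p (\<kappa> * (1 - p)) \<le> 4 * sqrt (6 * \<kappa> * (1 - p) * p / (\<kappa> * (1 - p) + 2))"
      using two_min_le_sqrt[of p "\<kappa> * (1 - p)"] assms by (simp add: mult.assoc)
    \<comment> \<open>The square root already covers \<open>2 * min p (\<kappa> * (1 - p))\<close>;
      the fraction can only enlarge the bound.\<close>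
    moreover have "0 \<le> 4 * \<kappa> * (1 - p) * p / (\<kappa> * (1 - p) + 2)"
      using assms by (intro divide_nonneg_nonneg) auto
    ultimately show ?thesis by linarith
  qed
  show ?thesis
    unfolding wasserstein_dist_def S_def[symmetric]
  proof (rule SUP_least)
    fix f :: "real \<Rightarrow> real"
    assume "f \<in> {f. \<forall>x y. \<bar>f x - f y\<bar> \<le> \<bar>x - y\<bar>}"
    then have f: "\<forall>x y. \<bar>f x - f y\<bar> \<le> \<bar>x - y\<bar>" by simp
    note [measurable] = nonexpansive_borel_measurable[OF f]
    \<comment> \<open>Integrability under both laws selects the finite branch in the definition of
      the distance.\<close>
    have "integrable ?G f"
      using G.nonexpansive_integrable[OF f, of "\<lambda>x. x"] gamma_distribution_mean[OF assms(2)]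
      by (auto simp: has_bochner_integral_iff)
    moreover have "integrable (distr M borel (\<lambda>\<omega>. p * S \<omega>)) f"
      using nonexpansive_integrable[OF f iW] by (subst integrable_distr_eq) simp_all
    moreover have "(\<integral>x. f x \<partial>distr M borel (\<lambda>\<omega>. p * S \<omega>)) = expectation (\<lambda>\<omega>. f (p * S \<omega>))"
      by (subst integral_distr) simp_all
    ultimately show "(if integrable (distr M borel (\<lambda>\<omega>. p * S \<omega>)) f \<and> integrable ?G f
        then ereal \<bar>(\<integral>x. f x \<partial>distr M borel (\<lambda>\<omega>. p * S \<omega>)) - (\<integral>x. f x \<partial>?G)\<bar> else \<infinity>)
      \<le> ereal (4 * sqrt (6 * \<kappa> * (1 - p) * p / (\<kappa> * (1 - p) + 2))
             + 4 * \<kappa> * (1 - p) * p / (\<kappa> * (1 - p) + 2)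
             + \<nu> * sqrt (\<kappa> * (1 - p) * p) + p * \<kappa>)"
      using main[OF f] by simp
  qed
qed

end
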